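(* Let $k\le 4$, let $(x_i,y_i)\in\mathbb{P}^2\times\mathbb{P}^2$ for $i=1,\dots,k$, and let $Z_k$ be the $k\times 9$ matrix with rows $x_i^\top\otimes y_i^\top$, $i=1,\dots,k$. Then: (1) $\operatorname{rank}(Z_2)<2$ if and only if $x_1=x_2$ and $y_1=y_2$. (2) $\operatorname{rank}(Z_3)<3$ if and only if either an inherited condition holds, or $x_1=x_2=x_3$ and $y_1,y_2,y_3$ are on a line, or $x_1,x_2,x_3$ are on a line and $y_1=y_2=y_3$. (3) $\operatorname{rank}(Z_4)<4$ if and only if an inherited condition holds or one of the following is true: (a) $x_1=x_2=x_3=x_4$ or $y_1=y_2=y_3=y_4$; (b) the points $x_1,\dots,x_4$ are in a line, the points $y_1,\dots,y_4$ are in a line, and $$[13]_x[24]_x[14]_y[23]_y=[14]_x[23]_x[13]_y[24]_y.$$ Generically, the collinear points $x_1,\dots,x_4$ are distinct and the collinear points $y_1,\dots,y_4$ are distinct, and in that case the bracket equation in (b) holds if and only if there is a homography $H\in\mathrm{PGL}(3)$ such that $Hx_i=y_i$ in $\mathbb{P}^2$ for $i=1,\dots,4$.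
   Context: $\mathbb{P}^n$ is projective space over $\mathbb{C}$; points are represented by nonzero column vectors (the rank of $Z_k$ does not depend on the choice of representatives). $\otimes$ is the Kronecker product. An inherited condition holds for $Z_k$ if the rows of $Z_k$ indexed by some proper subset of $\{1,\dots,k\}$ are linearly dependent. For points on a line in $\mathbb{P}^2$, the bracket $[ij]$ is computed by identifying the line with $\mathbb{P}^1$ (apply a homography taking the line to $\{( *,*,0)\}$ and drop the $0$ coordinate) and setting $[ij]=\det\begin{bmatrix} p_{i1} & p_{i2} \\ p_{j1} & p_{j2} \end{bmatrix}$; $[ij]_x$ and $[ij]_y$ denote these brackets for the $x_i$ and the $y_i$. The validity of the bracket equation is independent of the choices made. *)

theory Defs
  imports "HOL-Analysis.Analysis"
begin

text \<open>
  A point of the complex projective plane is represented by a nonzero vector of type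
  \<^typ>\<open>complex^3\<close>, and a family of points indexed by \<open>1,\<dots>,k\<close> by a function on the
  numeral type with \<open>k\<close> elements. (In the type \<open>4\<close> the element \<open>4\<close> is the same as \<open>0\<close>; the
  elements \<open>1, 2, 3, 4\<close> are distinct and exhaust the type. Likewise for \<open>2\<close> and \<open>3\<close>.)
\<close>

definition same_point :: "complex^3 \<Rightarrow> complex^3 \<Rightarrow> bool" where
  "same_point p q \<longleftrightarrow> (\<exists>c. c \<noteq> 0 \<and> q = c *s p)"

definition representatives :: "('i \<Rightarrow> complex^3) \<Rightarrow> bool" where
  "representatives x \<longleftrightarrow> (\<forall>i. x i \<noteq> 0)"

definition distinct_points :: "('i \<Rightarrow> complex^3) \<Rightarrow> bool" where
  "distinct_points x \<longleftrightarrow> (\<forall>i j. i \<noteq> j \<longrightarrow> \<not> same_point (x i) (x j))"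

text \<open>
  The line with coefficient vector \<open>l\<close>. The product is bilinear, not Hermitian.
\<close>

definition on_line :: "complex^3 \<Rightarrow> complex^3 \<Rightarrow> bool" where
  "on_line l p \<longleftrightarrow> (\<Sum>j\<in>UNIV. l $ j * p $ j) = 0"

definition on_a_line :: "('i \<Rightarrow> complex^3) \<Rightarrow> bool" where
  "on_a_line x \<longleftrightarrow> (\<exists>l. l \<noteq> 0 \<and> (\<forall>i. on_line l (x i)))"

text \<open>
  The Kronecker product of two vectors has its entries indexed by pairs (lexicographically
  ordered in the usual display). Hence \<open>Z_matrix x y\<close> is a \<open>k \<times> 9\<close> matrix, its columns being
  indexed by the nine elements of the type \<open>3 \<times> 3\<close>.
\<close>

definition kronecker :: "complex^'m \<Rightarrow> complex^'n \<Rightarrow> complex^('m \<times> 'n)" where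
  "kronecker u v = (\<chi> ij. u $ fst ij * v $ snd ij)"

definition Z_matrix :: "('k \<Rightarrow> complex^3) \<Rightarrow> ('k \<Rightarrow> complex^3) \<Rightarrow> complex^(3 \<times> 3)^'k" where
  "Z_matrix x y = (\<chi> i. kronecker (x i) (y i))"

text \<open>
  Linear dependence of the rows as an indexed family: two equal rows are dependent.
\<close>

definition rows_dependent :: "complex^'n^'k \<Rightarrow> 'k set \<Rightarrow> bool" where
  "rows_dependent A S \<longleftrightarrow> (\<exists>c. (\<exists>i\<in>S. c i \<noteq> 0) \<and> (\<Sum>i\<in>S. c i *s row i A) = 0)"

definition inherited_condition :: "complex^'n^'k \<Rightarrow> bool" where
  "inherited_condition A \<longleftrightarrow> (\<exists>S. S \<subset> UNIV \<and> rows_dependent A S)"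

text \<open>
  \<open>flattens l H\<close>: the homography \<open>H\<close> takes the line \<open>l\<close> to the line \<open>{(*,*,0)}\<close>.
\<close>

definition flattens :: "complex^3 \<Rightarrow> complex^3^3 \<Rightarrow> bool" where
  "flattens l H \<longleftrightarrow> invertible H \<and> (\<forall>p. on_line l p \<longleftrightarrow> (H *v p) $ 3 = 0)"

definition bracket :: "complex^3^3 \<Rightarrow> complex^3 \<Rightarrow> complex^3 \<Rightarrow> complex" where
  "bracket H p q =
     det (vector [vector [(H *v p) $ 1, (H *v p) $ 2],
                  vector [(H *v q) $ 1, (H *v q) $ 2]] :: complex^2^2)"

definition bracket_equation_wrt ::
  "complex^3^3 \<Rightarrow> complex^3^3 \<Rightarrow> (4 \<Rightarrow> complex^3) \<Rightarrow> (4 \<Rightarrow> complex^3) \<Rightarrow> bool" where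
  "bracket_equation_wrt H K x y \<longleftrightarrow>
     bracket H (x 1) (x 3) * bracket H (x 2) (x 4) * bracket K (y 1) (y 4) * bracket K (y 2) (y 3)
   = bracket H (x 1) (x 4) * bracket H (x 2) (x 3) * bracket K (y 1) (y 3) * bracket K (y 2) (y 4)"

text \<open>
  The existential quantifier over lines and homographies could equally be a universal one,
  and the choice of representatives does not matter either; see
  \<open>bracket_equation_iff\<close> and \<open>bracket_equation_rescale\<close> below.
\<close>

definition bracket_equation :: "(4 \<Rightarrow> complex^3) \<Rightarrow> (4 \<Rightarrow> complex^3) \<Rightarrow> bool" where
  "bracket_equation x y \<longleftrightarrow>
     (\<exists>l m H K. (\<forall>i. on_line l (x i)) \<and> (\<forall>i. on_line m (y i)) \<and>
        flattens l H \<and> flattens m K \<and> bracket_equation_wrt H K x y)"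

text \<open>
  Zariski topology on a product of projective planes, one for each element of \<open>'i\<close>: the closed
  sets are the common zero sets of multihomogeneous polynomials, here described through all
  representatives of the points.
\<close>

inductive polynomial_map :: "(('i \<Rightarrow> complex^3) \<Rightarrow> complex) \<Rightarrow> bool" where
  const: "polynomial_map (\<lambda>z. c)"
| coord: "polynomial_map (\<lambda>z. z i $ j)"
| add: "polynomial_map f \<Longrightarrow> polynomial_map g \<Longrightarrow> polynomial_map (\<lambda>z. f z + g z)"
| mult: "polynomial_map f \<Longrightarrow> polynomial_map g \<Longrightarrow> polynomial_map (\<lambda>z. f z * g z)"

definition multihomogeneous :: "(('i::finite \<Rightarrow> complex^3) \<Rightarrow> complex) \<Rightarrow> bool" where
  "multihomogeneous f \<longleftrightarrow>
     (\<exists>d :: 'i \<Rightarrow> nat. \<forall>c z. f (\<lambda>i. c i *s z i) = (\<Prod>i\<in>UNIV. c i ^ d i) * f z)"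

definition zariski_closed :: "('i::finite \<Rightarrow> complex^3) set \<Rightarrow> bool" where
  "zariski_closed S \<longleftrightarrow>
     (\<exists>F. (\<forall>f\<in>F. polynomial_map f \<and> multihomogeneous f) \<and>
          S = {z. representatives z \<and> (\<forall>f\<in>F. f z = 0)})"

text \<open>
  \<open>P\<close> holds generically on \<open>V\<close>: it holds on a relatively Zariski open subset \<open>V - S\<close>
  that is Zariski dense in \<open>V\<close>.
\<close>

definition generically_on ::
  "('i::finite \<Rightarrow> complex^3) set \<Rightarrow> (('i \<Rightarrow> complex^3) \<Rightarrow> bool) \<Rightarrow> bool" where
  "generically_on V P \<longleftrightarrow>
     (\<exists>S. zariski_closed S \<and> (\<forall>z\<in>V - S. P z) \<and>
          (\<forall>T. zariski_closed T \<and> V - S \<subseteq> T \<longrightarrow> V \<subseteq> T))"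

subsection \<open>Independence of the choices\<close>

lemma bracket_eq:
  "bracket H p q = (H *v p) $ 1 * (H *v q) $ 2 - (H *v p) $ 2 * (H *v q) $ 1"
  by (simp add: bracket_def det_2)

lemma bracket_scale: "bracket H (a *s p) (b *s q) = a * b * bracket H p q"
  by (simp add: bracket_eq vector_scalar_commute algebra_simps)

lemma bracket_change_homography:
  fixes x :: "'i \<Rightarrow> complex^3"
  assumes "flattens l H" "flattens l' H'"
    and l: "\<And>i. on_line l (x i)" and l': "\<And>i. on_line l' (x i)"
  shows "\<exists>c. c \<noteq> 0 \<and> (\<forall>i j. bracket H' (x i) (x j) = c * bracket H (x i) (x j))"
proof -
  have inv: "invertible H" "invertible H'" using assms by (auto simp: flattens_def)
  obtain G where G: "G ** H = mat 1" using inv by (auto simp: invertible_def)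
  define M where "M = H' ** G"
  have M: "H' *v p = M *v (H *v p)" for p
    by (simp add: M_def matrix_vector_mul_assoc matrix_mul_assoc [symmetric] G)
  have detM: "det M \<noteq> 0"
  proof -
    have "M ** H = H'"
      by (simp add: M_def matrix_mul_assoc [symmetric] G)
    then have "det M * det H = det H'" by (metis det_mul)
    then show ?thesis using inv by (auto simp: invertible_det_nz)
  qed
  define m where "m = M$1$1 * M$2$2 - M$1$2 * M$2$1"
  have z: "(H *v x i) $ 3 = 0" "(H' *v x i) $ 3 = 0" for i
    using assms by (auto simp: flattens_def)
  have comp: "(H' *v p) $ r = M$r$1 * (H *v p)$1 + M$r$2 * (H *v p)$2 + M$r$3 * (H *v p)$3"
    for p r
    by (simp add: M matrix_vector_mult_def [of M] sum_3)
  have br: "bracket H' (x i) (x j) = m * bracket H (x i) (x j)" for i j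
    unfolding bracket_eq comp z m_def by (simp add: algebra_simps)
  show ?thesis
  proof (cases "\<forall>i j. bracket H (x i) (x j) = 0")
    case True
    then show ?thesis using br by (intro exI [of _ 1]) auto
  next
    case False
    then obtain i j where ij: "bracket H (x i) (x j) \<noteq> 0" by auto
    define a b c d where "a = (H *v x i)$1" "b = (H *v x i)$2" "c = (H *v x j)$1" "d = (H *v x j)$2"
    note abcd = this
    have nz: "a * d - b * c \<noteq> 0" using ij by (simp add: bracket_eq abcd)
    have e1: "M$3$1 * a + M$3$2 * b = 0"
      using comp [of "x i" 3] z by (simp add: abcd)
    have e2: "M$3$1 * c + M$3$2 * d = 0"
      using comp [of "x j" 3] z by (simp add: abcd)
    have "M$3$1 * (a * d - b * c) = (M$3$1 * a + M$3$2 * b) * d - (M$3$1 * c + M$3$2 * d) * b"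
      by (simp add: algebra_simps)
    then have "M$3$1 = 0" using e1 e2 nz by simp
    have "M$3$2 * (a * d - b * c) = (M$3$1 * c + M$3$2 * d) * a - (M$3$1 * a + M$3$2 * b) * c"
      by (simp add: algebra_simps)
    then have "M$3$2 = 0" using e1 e2 nz by simp
    have "det M = m * M$3$3"
      unfolding det_3 m_def by (simp add: \<open>M$3$1 = 0\<close> \<open>M$3$2 = 0\<close> algebra_simps)
    then have "m \<noteq> 0" using detM by auto
    then show ?thesis using br by blast
  qed
qed

lemma bracket_equation_iff:
  assumes "flattens l H" "flattens m K"
    and "\<And>i. on_line l (x i)" and "\<And>i. on_line m (y i)"
  shows "bracket_equation x y \<longleftrightarrow> bracket_equation_wrt H K x y"
proof
  assume "bracket_equation_wrt H K x y"
  then show "bracket_equation x y" using assms unfolding bracket_equation_def by blast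
next
  assume "bracket_equation x y"
  then obtain l' m' H' K' where *: "flattens l' H'" "flattens m' K'"
    "\<And>i. on_line l' (x i)" "\<And>i. on_line m' (y i)" and eq: "bracket_equation_wrt H' K' x y"
    unfolding bracket_equation_def by blast
  obtain c where c: "c \<noteq> 0" "\<forall>i j. bracket H (x i) (x j) = c * bracket H' (x i) (x j)"
    using bracket_change_homography [where x = x, OF *(1) assms(1) *(3) assms(3)]
    by (elim exE conjE)
  obtain d where d: "d \<noteq> 0" "\<forall>i j. bracket K (y i) (y j) = d * bracket K' (y i) (y j)"
    using bracket_change_homography [where x = y, OF *(2) assms(2) *(4) assms(4)]
    by (elim exE conjE)
  show "bracket_equation_wrt H K x y"
  proof -
    have "c * p * (c * q) * (d * r) * (d * s) = c * p' * (c * q') * (d * r') * (d * s')"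
      if "p * q * r * s = p' * q' * r' * s'" for p q r s p' q' r' s'
    proof -
      have "c * p * (c * q) * (d * r) * (d * s) = c * c * d * d * (p * q * r * s)"
        by (simp only: ac_simps)
      also have "\<dots> = c * p' * (c * q') * (d * r') * (d * s')"
        unfolding that by (simp only: ac_simps)
      finally show ?thesis .
    qed
    then show ?thesis using eq unfolding bracket_equation_wrt_def c(2) [rule_format] d(2) [rule_format] .
  qed
qed

lemma bracket_equation_rescale:
  assumes "\<And>i. a i \<noteq> 0" "\<And>i. b i \<noteq> 0"
  shows "bracket_equation (\<lambda>i. a i *s x i) (\<lambda>i. b i *s y i) \<longleftrightarrow> bracket_equation x y"
proof -
  have on: "on_line l (c *s p) \<longleftrightarrow> on_line l p" if "c \<noteq> 0" for l p c
  proof -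
    have "(\<Sum>j\<in>UNIV. l $ j * (c *s p) $ j) = c * (\<Sum>j\<in>UNIV. l $ j * p $ j)"
      by (simp add: sum_distrib_left ac_simps)
    then show ?thesis using that by (simp add: on_line_def)
  qed
  have "bracket_equation_wrt H K (\<lambda>i. a i *s x i) (\<lambda>i. b i *s y i) \<longleftrightarrow>
        bracket_equation_wrt H K x y" for H K
  proof -
    have "a 1 * a 3 * p * (a 2 * a 4 * q) * (b 1 * b 4 * r) * (b 2 * b 3 * s)
        = a 1 * a 4 * p' * (a 2 * a 3 * q') * (b 1 * b 3 * r') * (b 2 * b 4 * s')
        \<longleftrightarrow> p * q * r * s = p' * q' * r' * s'" for p q r s p' q' r' s'
    proof -
      define k where "k = a 1 * a 2 * a 3 * a 4 * b 1 * b 2 * b 3 * b 4"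
      have "a 1 * a 3 * p * (a 2 * a 4 * q) * (b 1 * b 4 * r) * (b 2 * b 3 * s)
          = k * (p * q * r * s)"
        unfolding k_def by (simp only: ac_simps)
      moreover have "a 1 * a 4 * p' * (a 2 * a 3 * q') * (b 1 * b 3 * r') * (b 2 * b 4 * s')
          = k * (p' * q' * r' * s')"
        unfolding k_def by (simp only: ac_simps)
      moreover have "k \<noteq> 0" using assms by (simp add: k_def)
      ultimately show ?thesis by (simp only: mult_cancel_left) simp
    qed
    then show ?thesis unfolding bracket_equation_wrt_def bracket_scale .
  qed
  then show ?thesis using assms unfolding bracket_equation_def by (simp add: on)
qed

end

theory Submission
  imports Defs
begin

text \<open>
  A dependency between the rows \<open>x\<^sub>i \<otimes> y\<^sub>i\<close> is a relation \<open>\<Sum> c\<^sub>i (x\<^sub>i \<otimes> y\<^sub>i) = 0\<close>, and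
  the rank is smaller than \<open>k\<close> exactly if there is one with \<open>c \<noteq> 0\<close>. If no inherited condition
  holds, all \<open>c\<^sub>i\<close> are nonzero.

  Contracting such a relation with a linear form \<open>l\<close> in the first factor gives the linear relation
  \<open>\<Sum> c\<^sub>i l(x\<^sub>i) y\<^sub>i = 0\<close>. Suppose that \<open>y\<^sub>i\<close> and \<open>y\<^sub>j\<close> are different points. If \<open>l\<close> vanishes at
  every \<open>x\<^sub>m\<close> with \<open>m \<noteq> i, j\<close>, only two terms survive, and the independence of \<open>y\<^sub>i\<close> and \<open>y\<^sub>j\<close> forces
  \<open>l\<close> to vanish at \<open>x\<^sub>i\<close> and \<open>x\<^sub>j\<close> as well (\<open>annihilator_transfer\<close>). So all the \<open>x\<^sub>m\<close> lie in the span of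
  \<open>k - 2\<close> of them. For \<open>k = 2\<close> this is impossible; for \<open>k = 3\<close> it says that the \<open>x\<^sub>m\<close>
  coincide, and contracting with a form that does not vanish at this point gives a relation between
  the \<open>y\<^sub>m\<close>; for \<open>k = 4\<close> it says that the \<open>x\<^sub>m\<close> are collinear. With the same argument in
  the other factor, what is left for \<open>k = 4\<close>, apart from quadruples that consist of a single point,
  is the case of two collinear quadruples.

  Two collinear quadruples have coordinates \<open>u\<^sub>i, v\<^sub>i\<close> in a plane vector space. The two bilinear forms
  \<open>[u\<^sub>1, \<cdot>] [v\<^sub>2, \<cdot>]\<close> and \<open>[u\<^sub>2, \<cdot>] [v\<^sub>1, \<cdot>]\<close> vanish at the first two pairs \<open>(u\<^sub>i, v\<^sub>i)\<close>, and the bracket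
  equation is the vanishing of the determinant of their values at the last two. A relation with
  \<open>c\<^sub>3 \<noteq> 0\<close> makes that determinant zero (\<open>cross_equation_of_relation\<close>). Conversely, if it is zero,
  some combination of the two forms vanishes at all four pairs. Either that combination
  is a nonzero form on the four-dimensional tensor product, so that four tensors in its kernel are
  dependent, or the two forms are proportional, and then \<open>u\<^sub>1 \<otimes> v\<^sub>1\<close> and \<open>u\<^sub>2 \<otimes> v\<^sub>2\<close> are
  (\<open>relation_of_cross_equation\<close>).

  For distinct points the bracket equation is the equality of two cross ratios. The linear map with
  \<open>u\<^sub>1 \<mapsto> a v\<^sub>1\<close>, \<open>u\<^sub>2 \<mapsto> b v\<^sub>2\<close> sends the third point to the third one for a suitable ratio
  \<open>a : b\<close>, and then the equation says that the fourth point goes to the fourth one.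

  Distinctness is generic because pairs of collinear quadruples are parametrized by a vector space:
  the parameters of a given pair can be joined, by a polynomial curve, to those of one where an
  explicit polynomial \<open>f\<close>, which is zero whenever two points of a quadruple coincide, is nonzero. On
  the curve \<open>f\<close> has finitely many zeros, so that every polynomial that vanishes where \<open>f\<close> does not
  vanishes at the given pair (\<open>generically_distinct\<close>).
\<close>

section \<open>Linear forms\<close>

definition pairing :: "'a::comm_semiring_1^'n \<Rightarrow> 'a^'n \<Rightarrow> 'a" where
  "pairing l p = (\<Sum>j\<in>UNIV. l $ j * p $ j)"

lemma on_line_iff_pairing: "on_line l p \<longleftrightarrow> pairing l p = 0"
  by (simp add: on_line_def pairing_def)

lemma matrix_vector_mult_nth: "(A *v p) $ i = pairing (A $ i) p"
  by (simp add: matrix_vector_mult_def pairing_def)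

lemma pairing_commute: "pairing l p = pairing p l"
  by (simp add: pairing_def mult.commute)

lemma pairing_scale [simp]:
  "pairing l (c *s p) = c * pairing l p" "pairing (c *s l) p = c * pairing l p"
  by (simp_all add: pairing_def sum_distrib_left ac_simps)

lemma pairing_add [simp]:
  "pairing l (p + q) = pairing l p + pairing l q"
  "pairing (l + m) p = pairing l p + pairing m p"
  by (simp_all add: pairing_def sum.distrib algebra_simps)

lemma pairing_diff [simp]:
  fixes p q :: "'a::comm_ring_1^'n"
  shows "pairing l (p - q) = pairing l p - pairing l q"
  "pairing (p - q) l = pairing p l - pairing q l"
  by (simp_all add: pairing_def sum_subtractf algebra_simps)

lemma pairing_sum: "pairing l (\<Sum>i\<in>S. f i) = (\<Sum>i\<in>S. pairing l (f i))"
  by (simp add: pairing_def sum_distrib_left sum.swap [of _ S])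

lemma pairing_zero [simp]: "pairing l 0 = 0" "pairing 0 p = 0"
  by (simp_all add: pairing_def)

lemma pairing_axis [simp]: "pairing (axis a 1) p = p $ a" "pairing p (axis a 1) = p $ a"
  by (simp_all add: pairing_def axis_def if_distrib if_distribR cong: if_cong)

lemma pairing_separates:
  fixes p :: "'a::comm_semiring_1^'n"
  assumes "p \<noteq> 0"
  obtains l where "pairing l p \<noteq> 0"
  using assms by (metis pairing_axis(1) vec_eq_iff zero_index)

text \<open>
  A square matrix is left invertible exactly if it is right invertible; the left-hand side describes
  its kernel, the right-hand side the relations between its rows.
\<close>

lemma common_annihilator_iff_dependent:
  fixes x :: "'n::finite \<Rightarrow> 'a::field^'n"
  shows "(\<exists>l. l \<noteq> 0 \<and> (\<forall>i. pairing l (x i) = 0)) \<longleftrightarrow>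
         (\<exists>c. (\<exists>i. c i \<noteq> 0) \<and> (\<Sum>i\<in>UNIV. c i *s x i) = 0)"
proof -
  define A where "A = (\<chi> i. x i)"
  have ker: "A *v l = 0 \<longleftrightarrow> (\<forall>i. pairing l (x i) = 0)" for l
    by (simp add: vec_eq_iff matrix_vector_mult_nth A_def pairing_commute)
  have "(\<exists>l. l \<noteq> 0 \<and> (\<forall>i. pairing l (x i) = 0)) \<longleftrightarrow> \<not> (\<exists>B. B ** A = mat 1)"
    unfolding matrix_left_invertible_ker ker by blast
  also have "\<dots> \<longleftrightarrow> \<not> (\<exists>B. A ** B = mat 1)"
    by (metis matrix_left_right_inverse)
  also have "\<dots> \<longleftrightarrow> (\<exists>c. (\<exists>i. c i \<noteq> 0) \<and> (\<Sum>i\<in>UNIV. c i *s x i) = 0)"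
    unfolding matrix_right_invertible_independent_rows by (auto simp: A_def row_def vec_lambda_eta)
  finally show ?thesis .
qed

lemma line_through_two_points:
  fixes p q :: "complex^3"
  obtains l where "l \<noteq> 0" "pairing l p = 0" "pairing l q = 0"
proof -
  define x :: "3 \<Rightarrow> complex^3" where "x i = (if i = 1 then p else q)" for i
  define c :: "3 \<Rightarrow> complex" where "c i = (if i = 1 then 0 else if i = 2 then 1 else -1)" for i
  have "(\<Sum>i\<in>UNIV. c i *s x i) = 0" "c 2 \<noteq> 0"
    by (simp_all add: sum_3 c_def x_def vec_eq_iff)
  then obtain l where "l \<noteq> 0" "\<forall>i. pairing l (x i) = 0"
    using common_annihilator_iff_dependent [of x] by blast
  moreover have "x 1 = p" "x 2 = q" by (simp_all add: x_def)
  ultimately show thesis using that by metis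
qed

section \<open>Rank and relations between tensors\<close>

text \<open>
  The rank is defined from the set of rows, which forgets repetitions, whereas dependence concerns
  the indexed family. A repeated row keeps the rank below the number of rows and is also a dependence, so that the
  two conditions agree.
\<close>

lemma rank_less_iff_rows_dependent:
  fixes A :: "complex^'n^'k"
  shows "rank A < CARD('k) \<longleftrightarrow> rows_dependent A UNIV"
proof
  assume less: "rank A < CARD('k)"
  show "rows_dependent A UNIV"
  proof (rule ccontr)
    assume "\<not> rows_dependent A UNIV"
    then have indep: "c i = 0" if "(\<Sum>i\<in>UNIV. c i *s row i A) = 0" for c i
      using that by (auto simp: rows_dependent_def)
    have inj: "inj (\<lambda>i. row i A)"
    proof (rule injI, rule ccontr)
      fix i j assume ij: "row i A = row j A" "i \<noteq> j"
      define c where "c k = (if k = i then 1 else if k = j then -1 else 0 :: complex)" for k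
      have "(\<Sum>k\<in>UNIV. c k *s row k A) = (\<Sum>k\<in>{i,j}. c k *s row k A)"
        by (rule sum.mono_neutral_right) (auto simp: c_def)
      also have "\<dots> = 0" using ij by (simp add: c_def)
      finally have "c i = 0" by (rule indep)
      then show False by (simp add: c_def)
    qed
    have "vec.independent (rows A)"
    proof (rule vec.independent_if_scalars_zero)
      have eq: "rows A = range (\<lambda>i. row i A)" by (auto simp: rows_def)
      show "finite (rows A)" by (simp add: eq)
      fix f v assume f: "(\<Sum>v\<in>rows A. f v *s v) = 0" and v: "v \<in> rows A"
      have "(\<Sum>i\<in>UNIV. f (row i A) *s row i A) = 0"
        using f unfolding eq sum.reindex [OF inj] by simp
      with indep [of "\<lambda>i. f (row i A)"] v show "f v = 0" by (auto simp: eq)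
    qed
    then have "rank A = card (rows A)"
      by (simp add: row_rank_def_gen vec.dim_eq_card_independent)
    also have "\<dots> = CARD('k)"
    proof -
      have "rows A = range (\<lambda>i. row i A)" by (auto simp: rows_def)
      then show ?thesis by (simp add: card_image inj)
    qed
    finally show False using less by simp
  qed
next
  assume "rows_dependent A UNIV"
  then obtain c k where k: "c k \<noteq> 0" and c: "(\<Sum>i\<in>UNIV. c i *s row i A) = 0"
    by (auto simp: rows_dependent_def)
  define R where "R = (\<lambda>i. row i A) ` (UNIV - {k})"
  have "c k *s row k A + (\<Sum>i\<in>UNIV - {k}. c i *s row i A) = 0"
    using c by (subst (asm) sum.remove [of _ k]) auto
  then have "row k A = (- inverse (c k)) *s (\<Sum>i\<in>UNIV - {k}. c i *s row i A)"
    using k by (simp add: vec_eq_iff eq_neg_iff_add_eq_0 field_simps)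
  also have "\<dots> \<in> vec.span R"
    by (intro vec.span_scale vec.span_sum) (auto simp: R_def intro: vec.span_base)
  finally have "row i A \<in> vec.span R" for i
    by (cases "i = k") (auto simp: R_def intro: vec.span_base)
  then have "vec.dim (rows A) \<le> card R"
    by (intro vec.dim_le_card) (auto simp: rows_def R_def)
  also have "\<dots> \<le> card (UNIV - {k})" unfolding R_def by (rule card_image_le) simp
  also have "\<dots> < CARD('k)" by (rule psubset_card_mono) auto
  finally show "rank A < CARD('k)" by (simp add: row_rank_def_gen)
qed

text \<open>
  The relation \<open>\<Sum> c\<^sub>i (x\<^sub>i \<otimes> y\<^sub>i) = 0\<close>, stated by evaluating bilinear forms: this makes it invariant
  under linear maps in both factors and gives the contractions without reference to coordinates.
\<close>

definition tensor_relation ::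
  "('k::finite \<Rightarrow> 'a::comm_semiring_1) \<Rightarrow> ('k \<Rightarrow> 'a^'m) \<Rightarrow> ('k \<Rightarrow> 'a^'n) \<Rightarrow> bool" where
  "tensor_relation c x y \<longleftrightarrow> (\<forall>l m. (\<Sum>i\<in>UNIV. c i * pairing l (x i) * pairing m (y i)) = 0)"

lemma tensor_relation_iff_coords:
  "tensor_relation c x y \<longleftrightarrow> (\<forall>a b. (\<Sum>i\<in>UNIV. c i * x i $ a * y i $ b) = 0)"
proof
  assume "tensor_relation c x y"
  then show "\<forall>a b. (\<Sum>i\<in>UNIV. c i * x i $ a * y i $ b) = 0"
    unfolding tensor_relation_def by (metis (no_types, lifting) pairing_axis(1) sum.cong)
next
  assume *: "\<forall>a b. (\<Sum>i\<in>UNIV. c i * x i $ a * y i $ b) = 0"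
  show "tensor_relation c x y" unfolding tensor_relation_def
  proof (intro allI)
    fix l m
    have "(\<Sum>i\<in>UNIV. c i * pairing l (x i) * pairing m (y i))
        = (\<Sum>i\<in>UNIV. \<Sum>a\<in>UNIV. \<Sum>b\<in>UNIV. l $ a * m $ b * (c i * x i $ a * y i $ b))"
      by (simp add: pairing_def sum_distrib_left sum_distrib_right ac_simps)
    also have "\<dots> = (\<Sum>a\<in>UNIV. \<Sum>b\<in>UNIV. l $ a * m $ b * (\<Sum>i\<in>UNIV. c i * x i $ a * y i $ b))"
      by (subst sum.swap, rule sum.cong [OF refl], subst sum.swap) (simp add: sum_distrib_left)
    finally show "(\<Sum>i\<in>UNIV. c i * pairing l (x i) * pairing m (y i)) = 0" using * by simp
  qed
qed

lemma tensor_relation_swap: "tensor_relation c x y \<longleftrightarrow> tensor_relation c y x"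
  unfolding tensor_relation_iff_coords by (subst all_comm) (simp only: ac_simps)

lemma tensor_relation_contract:
  "tensor_relation c x y \<longleftrightarrow> (\<forall>l. (\<Sum>i\<in>UNIV. (c i * pairing l (x i)) *s y i) = 0)"
  (is "_ \<longleftrightarrow> (\<forall>l. ?s l = 0)")
proof -
  have "pairing m (?s l) = (\<Sum>i\<in>UNIV. c i * pairing l (x i) * pairing m (y i))" for l m
    by (simp add: pairing_sum ac_simps)
  moreover have "?s l = 0 \<longleftrightarrow> (\<forall>m. pairing m (?s l) = 0)" for l
    using pairing_separates [of "?s l"] by auto
  ultimately show ?thesis by (simp add: tensor_relation_def)
qed

lemma rows_dependent_Z_matrix:
  "rows_dependent (Z_matrix x y) UNIV \<longleftrightarrow> (\<exists>c. (\<exists>i. c i \<noteq> 0) \<and> tensor_relation c x y)"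
  by (simp add: rows_dependent_def tensor_relation_iff_coords Z_matrix_def kronecker_def row_def
      vec_eq_iff ac_simps)

section \<open>Points of the projective plane\<close>

lemma same_point_iff_minors:
  assumes "p \<noteq> 0" "q \<noteq> 0"
  shows "same_point p q \<longleftrightarrow> (\<forall>a b. p $ a * q $ b = p $ b * q $ a)"
proof
  assume "same_point p q"
  then show "\<forall>a b. p $ a * q $ b = p $ b * q $ a" by (auto simp: same_point_def)
next
  assume eq: "\<forall>a b. p $ a * q $ b = p $ b * q $ a"
  obtain a where a: "p $ a \<noteq> 0" using assms(1) by (auto simp: vec_eq_iff)
  have q: "q = (q $ a / p $ a) *s p"
    using a eq by (simp add: vec_eq_iff field_simps)
  moreover have "q $ a / p $ a \<noteq> 0" using q assms(2) by auto
  ultimately show "same_point p q" unfolding same_point_def by metis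
qed

lemma same_point_refl: "same_point p p"
  unfolding same_point_def by (intro exI [of _ 1]) simp

lemma same_point_trans: "same_point p q \<Longrightarrow> same_point q r \<Longrightarrow> same_point p r"
  unfolding same_point_def by (metis mult_eq_0_iff vector_smult_assoc)

lemma same_point_sym: "same_point p q \<Longrightarrow> same_point q p"
  unfolding same_point_def
  by (metis vector_smult_assoc vector_smult_lid inverse_nonzero_iff_nonzero left_inverse)

lemma independent_of_distinct:
  assumes "p \<noteq> 0" "q \<noteq> 0" "\<not> same_point p q" and "a *s p + b *s q = 0"
  shows "a = 0 \<and> b = 0"
proof -
  have nth: "a * p $ k + b * q $ k = 0" for k
    using assms(4) by (simp add: vec_eq_iff)
  obtain i j where ij: "p $ i * q $ j - p $ j * q $ i \<noteq> 0" using assms same_point_iff_minors by auto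
  have "a * (p $ i * q $ j - p $ j * q $ i) = (a * p$i + b * q$i) * q$j - (a * p$j + b * q$j) * q$i"
    "b * (p $ i * q $ j - p $ j * q $ i) = (a * p$j + b * q$j) * p$i - (a * p$i + b * q$i) * p$j"
    by (simp_all add: algebra_simps)
  with ij show ?thesis unfolding nth by simp
qed

lemma same_point_if_lines:
  assumes "p \<noteq> 0" "q \<noteq> 0" and "\<And>l. pairing l p = 0 \<Longrightarrow> pairing l q = 0"
  shows "same_point p q"
  unfolding same_point_iff_minors [OF assms(1,2)]
proof (intro allI)
  fix a b
  let ?l = "p $ a *s axis b 1 - p $ b *s axis a 1 :: complex^3"
  have "pairing ?l p = 0" by simp
  then have "pairing ?l q = 0" by (rule assms(3))
  then show "p $ a * q $ b = p $ b * q $ a" by simp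
qed

text \<open>
  Contract the relation with \<open>l\<close>. Only the terms \<open>i\<close> and \<open>j\<close> can survive, and \<open>y i\<close> and \<open>y j\<close> are
  independent. Thus the \<open>x k\<close> with \<open>k \<noteq> i, j\<close> span all the others.
\<close>

lemma annihilator_transfer:
  assumes rel: "tensor_relation c x y" and c: "\<And>i. c i \<noteq> 0"
    and y: "representatives y" "\<not> same_point (y i) (y j)"
    and l: "\<And>k. k \<noteq> i \<Longrightarrow> k \<noteq> j \<Longrightarrow> pairing l (x k) = 0"
  shows "pairing l (x k) = 0"
proof -
  have ij: "i \<noteq> j" using y same_point_refl by metis
  have "0 = (\<Sum>k\<in>UNIV. (c k * pairing l (x k)) *s y k)"
    using rel by (simp add: tensor_relation_contract)
  also have "\<dots> = (\<Sum>k\<in>{i,j}. (c k * pairing l (x k)) *s y k)"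
    by (rule sum.mono_neutral_right) (auto simp: l)
  finally have "(c i * pairing l (x i)) *s y i + (c j * pairing l (x j)) *s y j = 0"
    using ij by simp
  then have "c i * pairing l (x i) = 0 \<and> c j * pairing l (x j) = 0"
    using y by (intro independent_of_distinct) (auto simp: representatives_def)
  then show ?thesis using c l by (cases "k = i \<or> k = j") auto
qed

section \<open>Inherited conditions and constant families\<close>

lemma rows_dependent_mono:
  fixes A :: "complex^'n^'k"
  assumes "rows_dependent A S" "S \<subseteq> T"
  shows "rows_dependent A T"
proof -
  obtain c i where i: "i \<in> S" "c i \<noteq> 0" and c: "(\<Sum>i\<in>S. c i *s row i A) = 0"
    using assms(1) by (auto simp: rows_dependent_def)
  have "(\<Sum>i\<in>T. (if i \<in> S then c i else 0) *s row i A) = (\<Sum>i\<in>S. c i *s row i A)"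
    using assms(2) by (intro sum.mono_neutral_cong_right) auto
  then show ?thesis unfolding rows_dependent_def using i c assms(2)
    by (intro exI [of _ "\<lambda>i. if i \<in> S then c i else 0"]) auto
qed

lemma inherited_imp_rank_less:
  fixes A :: "complex^'n^'k"
  assumes "inherited_condition A"
  shows "rank A < CARD('k)"
  using assms rows_dependent_mono [of A _ UNIV]
  unfolding rank_less_iff_rows_dependent inherited_condition_def by auto

text \<open>
  A vanishing coefficient would leave a relation on a proper subset of the rows.
\<close>

lemma rank_less_imp_full_relation:
  fixes x y :: "'k::finite \<Rightarrow> complex^3"
  assumes "rank (Z_matrix x y) < CARD('k)" "\<not> inherited_condition (Z_matrix x y)"
  obtains c where "\<And>i. c i \<noteq> 0" "tensor_relation c x y"
proof -
  obtain c i where i: "c i \<noteq> 0" and c: "(\<Sum>i\<in>UNIV. c i *s row i (Z_matrix x y)) = 0"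
    using assms(1) unfolding rank_less_iff_rows_dependent by (auto simp: rows_dependent_def)
  have "c j \<noteq> 0" for j
  proof
    assume j: "c j = 0"
    then have "(\<Sum>i\<in>UNIV - {j}. c i *s row i (Z_matrix x y)) = 0"
      using c by (subst (asm) sum.remove [of _ j]) auto
    moreover have "i \<in> UNIV - {j}" using i j by auto
    ultimately have "rows_dependent (Z_matrix x y) (UNIV - {j})"
      using i unfolding rows_dependent_def by blast
    then show False using assms(2) unfolding inherited_condition_def by blast
  qed
  moreover have "tensor_relation c x y"
    using c by (simp add: tensor_relation_iff_coords Z_matrix_def kronecker_def row_def
      vec_eq_iff ac_simps)
  ultimately show thesis by (rule that)
qed

lemma rank_Z_less_iff:
  fixes x y :: "'k::finite \<Rightarrow> complex^3"
  shows "rank (Z_matrix x y) < CARD('k) \<longleftrightarrow> (\<exists>c. (\<exists>i. c i \<noteq> 0) \<and> tensor_relation c x y)"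
  by (simp add: rank_less_iff_rows_dependent rows_dependent_Z_matrix)

lemma rank_Z_swap:
  fixes x y :: "'k::finite \<Rightarrow> complex^3"
  shows "rank (Z_matrix x y) < CARD('k) \<longleftrightarrow> rank (Z_matrix y x) < CARD('k)"
  unfolding rank_Z_less_iff by (metis tensor_relation_swap)

text \<open>
  For a fixed first factor the tensor product is linear in the second one, so that a relation between
  the \<open>y i\<close> carries over.
\<close>

lemma rank_Z_less_if_constant:
  fixes x y :: "'k::finite \<Rightarrow> complex^3"
  assumes same: "\<And>i. same_point p (x i)"
    and dep: "c j \<noteq> 0" "(\<Sum>i\<in>UNIV. c i *s y i) = 0"
  shows "rank (Z_matrix x y) < CARD('k)"
proof -
  obtain a where a: "\<And>i. a i \<noteq> 0" "\<And>i. x i = a i *s p"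
    using same unfolding same_point_def by metis
  have "(\<Sum>i\<in>UNIV. c i / a i * pairing l (x i) * pairing m (y i))
      = pairing l p * pairing m (\<Sum>i\<in>UNIV. c i *s y i)" for l m
    unfolding pairing_sum sum_distrib_left
    by (rule sum.cong) (simp_all add: a)
  then have "tensor_relation (\<lambda>i. c i / a i) x y"
    by (simp add: tensor_relation_def dep)
  then show ?thesis unfolding rank_Z_less_iff
    using a(1) dep(1) by (intro exI [of _ "\<lambda>i. c i / a i"]) auto
qed

lemma relation_if_constant:
  fixes x y :: "'k::finite \<Rightarrow> complex^3"
  assumes rel: "tensor_relation c x y" "c j \<noteq> 0" and x: "\<And>i. same_point p (x i)" "p \<noteq> 0"
  obtains d where "d j \<noteq> 0" "(\<Sum>i\<in>UNIV. d i *s y i) = 0"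
proof -
  obtain l where l: "pairing l p \<noteq> 0" using pairing_separates x(2) by blast
  have "pairing l (x i) \<noteq> 0" for i using x(1) [of i] l by (auto simp: same_point_def)
  then show thesis using rel that [of "\<lambda>i. c i * pairing l (x i)"]
    by (simp add: tensor_relation_contract)
qed

lemma vectors_dependent_of_card:
  fixes y :: "'k::finite \<Rightarrow> complex^'n"
  assumes "CARD('n) < CARD('k)"
  obtains c where "\<exists>i. c i \<noteq> 0" "(\<Sum>i\<in>UNIV. c i *s y i) = 0"
proof -
  have "rank (\<chi> i. y i) < CARD('k)"
    unfolding row_rank_def_gen using dim_subset_UNIV_cart_gen assms by (rule le_less_trans)
  then show thesis unfolding rank_less_iff_rows_dependent rows_dependent_def
    using that by (auto simp: row_def vec_lambda_eta)
qed

section \<open>Two and three points\<close>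

lemma rank_Z2_less_iff:
  fixes x y :: "2 \<Rightarrow> complex^3"
  assumes x: "representatives x" and y: "representatives y"
  shows "rank (Z_matrix x y) < 2 \<longleftrightarrow> same_point (x 1) (x 2) \<and> same_point (y 1) (y 2)"
proof
  assume "rank (Z_matrix x y) < 2"
  then obtain c i where i: "c i \<noteq> 0" and rel: "tensor_relation c x y"
    using rank_Z_less_iff [of x y] by auto
  \<comment> \<open>A single row is nonzero, so a relation between two rows involves both.\<close>
  have c: "c j \<noteq> 0" for j
  proof
    assume j: "c j = 0"
    obtain l m where lm: "pairing l (x i) \<noteq> 0" "pairing m (y i) \<noteq> 0"
      using x y pairing_separates unfolding representatives_def by metis
    have "0 = (\<Sum>k\<in>UNIV. c k * pairing l (x k) * pairing m (y k))"
      using rel by (simp add: tensor_relation_def)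
    also have "\<dots> = (\<Sum>k\<in>{i}. c k * pairing l (x k) * pairing m (y k))"
      by (rule sum.mono_neutral_right) (use i j exhaust_2 in \<open>auto, metis\<close>)
    finally show False using i lm by simp
  qed
  have "same_point (z 1) (z 2)" if rel: "tensor_relation c w z" and w: "representatives w"
    and z: "representatives z" for w z :: "2 \<Rightarrow> complex^3"
  proof (rule ccontr)
    assume "\<not> ?thesis"
    from annihilator_transfer [OF rel c z this] have "pairing l (w 1) = 0" for l
      using exhaust_2 by metis
    then show False using w pairing_separates unfolding representatives_def by metis
  qed
  then show "same_point (x 1) (x 2) \<and> same_point (y 1) (y 2)"
    using rel x y tensor_relation_swap by metis
next
  assume *: "same_point (x 1) (x 2) \<and> same_point (y 1) (y 2)"
  then obtain c where c: "y 2 = c *s y 1" unfolding same_point_def by blast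
  have "rank (Z_matrix x y) < CARD(2)"
  proof (rule rank_Z_less_if_constant)
    show "same_point (x 1) (x i)" for i
      using exhaust_2 [of i] * same_point_refl by auto
    show "(\<Sum>i\<in>UNIV. (if i = 1 then c else - 1) *s y i) = 0"
      by (simp add: sum_2 c)
    show "(if 2 = (1::2) then c else - 1) \<noteq> 0" by simp
  qed
  then show "rank (Z_matrix x y) < 2" by simp
qed

text \<open>
  By \<open>annihilator_transfer\<close> every line through the point with the third index contains the
  other two points, which therefore coincide with it.
\<close>

lemma constant_if_distinct:
  fixes x y :: "3 \<Rightarrow> complex^3"
  assumes x: "representatives x" and y: "representatives y"
    and rel: "tensor_relation c x y" "\<And>i. c i \<noteq> 0"
    and ij: "\<not> same_point (y i) (y j)"
  shows "same_point (x m) (x n)"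
proof -
  have "i \<noteq> j" using ij same_point_refl by metis
  then have "card (UNIV - {i, j}) = 1" by (simp add: card_Diff_subset)
  then obtain k where k: "UNIV - {i, j} = {k}" by (auto simp: card_1_singleton_iff)
  have "same_point (x k) (x m)" for m
  proof (rule same_point_if_lines)
    show "pairing l (x m) = 0" if "pairing l (x k) = 0" for l
    proof (rule annihilator_transfer [OF rel y ij])
      show "pairing l (x n) = 0" if "n \<noteq> i" "n \<noteq> j" for n
        using k that \<open>pairing l (x k) = 0\<close> by (metis DiffI UNIV_I empty_iff insert_iff)
    qed
  qed (use x in \<open>auto simp: representatives_def\<close>)
  then show ?thesis by (metis same_point_sym same_point_trans)
qed

text \<open>
  By \<open>annihilator_transfer\<close> a line through the two points with the remaining indices contains
  all four.
\<close>

lemma on_a_line_if_distinct: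
  fixes x y :: "4 \<Rightarrow> complex^3"
  assumes y: "representatives y"
    and rel: "tensor_relation c x y" "\<And>i. c i \<noteq> 0"
    and ij: "\<not> same_point (y i) (y j)"
  shows "on_a_line x"
proof -
  have "i \<noteq> j" using ij same_point_refl by metis
  then have "card (UNIV - {i, j}) = 2" by (simp add: card_Diff_subset)
  then obtain k k' where k: "UNIV - {i, j} = {k, k'}" by (auto simp: card_2_iff)
  obtain l where l: "l \<noteq> 0" "pairing l (x k) = 0" "pairing l (x k') = 0"
    by (rule line_through_two_points)
  have "pairing l (x m) = 0" for m
  proof (rule annihilator_transfer [OF rel y ij])
    show "pairing l (x n) = 0" if "n \<noteq> i" "n \<noteq> j" for n
      using k that l by (metis DiffI UNIV_I empty_iff insert_iff)
  qed
  then show ?thesis using l(1) by (auto simp: on_a_line_def on_line_iff_pairing)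
qed

lemma on_a_line_iff_dependent:
  fixes x :: "3 \<Rightarrow> complex^3"
  shows "on_a_line x \<longleftrightarrow> (\<exists>c. (\<exists>i. c i \<noteq> 0) \<and> (\<Sum>i\<in>UNIV. c i *s x i) = 0)"
  unfolding on_a_line_def on_line_iff_pairing by (rule common_annihilator_iff_dependent)

lemma rank_Z3_less_iff:
  fixes x y :: "3 \<Rightarrow> complex^3"
  assumes x: "representatives x" and y: "representatives y"
  shows "rank (Z_matrix x y) < 3 \<longleftrightarrow>
          inherited_condition (Z_matrix x y)
        \<or> (same_point (x 1) (x 2) \<and> same_point (x 2) (x 3) \<and> on_a_line y)
        \<or> (on_a_line x \<and> same_point (y 1) (y 2) \<and> same_point (y 2) (y 3))"
    (is "_ \<longleftrightarrow> ?inh \<or> ?A x y \<or> ?B")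
proof -
  have converse: "rank (Z_matrix x y) < CARD(3)" if "?A x y" for x y :: "3 \<Rightarrow> complex^3"
  proof -
    have "same_point (x 1) (x i)" for i
      using exhaust_3 [of i] that same_point_refl same_point_trans by metis
    then show ?thesis
      using that rank_Z_less_if_constant unfolding on_a_line_iff_dependent by blast
  qed
  have "?A x y \<or> ?B" if rank: "rank (Z_matrix x y) < CARD(3)" and inh: "\<not> ?inh"
  proof -
    obtain c where c: "\<And>i. c i \<noteq> 0" and rel: "tensor_relation c x y"
      using rank_less_imp_full_relation [OF rank inh] by blast
    have line: "on_a_line z" if "tensor_relation c w z" "\<And>i. same_point (w 1) (w i)" "w 1 \<noteq> 0"
      for w z :: "3 \<Rightarrow> complex^3"
      using relation_if_constant [OF that(1) c that(2,3)] unfolding on_a_line_iff_dependent by metis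
    show ?thesis
    proof (cases "\<forall>i j. same_point (y i) (y j)")
      case True
      then have "on_a_line x"
        using line [of y x] rel y unfolding representatives_def
        by (meson tensor_relation_swap)
      then show ?thesis using True by blast
    next
      case False
      then have "same_point (x i) (x j)" for i j
        using constant_if_distinct [OF x y rel c] by blast
      moreover from this have "on_a_line y"
        using line [of x y] rel x unfolding representatives_def by blast
      ultimately show ?thesis by blast
    qed
  qed
  moreover have "rank (Z_matrix x y) < CARD(3)" if "?B"
    using converse [of y x] that rank_Z_swap [of x y] by simp
  ultimately show ?thesis
    using converse inherited_imp_rank_less [of "Z_matrix x y"] by auto
qed

section \<open>The bracket equation as a condition on planar tensors\<close>

definition bracket2 :: "'a::comm_ring_1^2 \<Rightarrow> 'a^2 \<Rightarrow> 'a" where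
  "bracket2 p q = p $ 1 * q $ 2 - p $ 2 * q $ 1"

text \<open>
  The bracket equation after the two lines have been identified with the projective line.
\<close>

definition cross_equation :: "(4 \<Rightarrow> complex^2) \<Rightarrow> (4 \<Rightarrow> complex^2) \<Rightarrow> bool" where
  "cross_equation u v \<longleftrightarrow>
     bracket2 (u 1) (u 3) * bracket2 (u 2) (u 4) * bracket2 (v 1) (v 4) * bracket2 (v 2) (v 3)
   = bracket2 (u 1) (u 4) * bracket2 (u 2) (u 3) * bracket2 (v 1) (v 3) * bracket2 (v 2) (v 4)"

lemma pairing_bracket2:
  "pairing (vector [- p $ 2, p $ 1]) q = bracket2 p q"
  by (simp add: pairing_def sum_2 bracket2_def)

lemma two_by_two_singular_iff:
  fixes a b c d :: "'a::field"
  shows "(\<exists>s t. (s \<noteq> 0 \<or> t \<noteq> 0) \<and> s * a + t * b = 0 \<and> s * c + t * d = 0) \<longleftrightarrow> a * d = b * c"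
    (is "?L \<longleftrightarrow> ?R")
proof
  assume ?L
  then obtain s t where st: "s \<noteq> 0 \<or> t \<noteq> 0" and e: "s * a + t * b = 0" "s * c + t * d = 0" by blast
  have "s * (a * d - b * c) = (s * a + t * b) * d - (s * c + t * d) * b"
    "t * (a * d - b * c) = (s * c + t * d) * a - (s * a + t * b) * c"
    by (simp_all add: algebra_simps)
  then show ?R using st e by auto
next
  assume ?R
  show ?L
  proof (cases "a = 0 \<and> b = 0")
    case True
    show ?thesis
    proof (cases "c = 0 \<and> d = 0")
      case False
      then show ?thesis using True by (intro exI [of _ d] exI [of _ "- c"]) auto
    qed (use True in \<open>auto intro: exI [of _ 1]\<close>)
  next
    case False
    then show ?thesis using \<open>?R\<close> by (intro exI [of _ b] exI [of _ "- a"]) (auto simp: algebra_simps)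
  qed
qed

text \<open>
  The forms \<open>[u 1, \<cdot>] [v 2, \<cdot>]\<close> and \<open>[u 2, \<cdot>] [v 1, \<cdot>]\<close> kill the first two terms of the relation. What
  remains are two equations for \<open>(c 3, c 4)\<close>, whose determinant gives the cross equation.
\<close>

lemma cross_equation_of_relation:
  assumes rel: "tensor_relation c u v" and c: "c 3 \<noteq> 0"
  shows "cross_equation u v"
proof -
  have br: "c 3 * (bracket2 p (u 3) * bracket2 q (v 3)) + c 4 * (bracket2 p (u 4) * bracket2 q (v 4)) = 0"
    if "p = u 1 \<and> q = v 2 \<or> p = u 2 \<and> q = v 1" for p q
  proof -
    have "(\<Sum>i\<in>UNIV. c i * bracket2 p (u i) * bracket2 q (v i)) = 0"
      using rel unfolding tensor_relation_def pairing_bracket2 [symmetric] by blast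
    moreover have "bracket2 r r = 0" for r :: "complex^2" by (simp add: bracket2_def)
    ultimately show ?thesis using that by (auto simp: sum_4 algebra_simps)
  qed
  have "bracket2 (u 1) (u 3) * bracket2 (v 2) (v 3) * (bracket2 (u 2) (u 4) * bracket2 (v 1) (v 4))
      = bracket2 (u 1) (u 4) * bracket2 (v 2) (v 4) * (bracket2 (u 2) (u 3) * bracket2 (v 1) (v 3))"
    using br [of "u 1" "v 2"] br [of "u 2" "v 1"] c two_by_two_singular_iff by blast
  then show ?thesis by (simp add: cross_equation_def ac_simps)
qed

text \<open>
  The cross equation provides a combination of \<open>[u 1, \<cdot>] [v 2, \<cdot>]\<close> and \<open>[u 2, \<cdot>] [v 1, \<cdot>]\<close> that vanishes at
  all four pairs. If it is nonzero, it annihilates four tensors in a four-dimensional space. If it is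
  zero, the two forms are proportional. Points of a quadruple may coincide.
\<close>

lemma relation_of_cross_equation:
  fixes u v :: "4 \<Rightarrow> complex^2"
  assumes u: "\<And>i. u i \<noteq> 0" and v: "\<And>i. v i \<noteq> 0" and eq: "cross_equation u v"
  shows "\<exists>c. (\<exists>i. c i \<noteq> 0) \<and> tensor_relation c u v"
proof -
  define P where "P i = bracket2 (u 1) (u i) * bracket2 (v 2) (v i)" for i
  define Q where "Q i = bracket2 (u 2) (u i) * bracket2 (v 1) (v i)" for i
  have "P 3 * Q 4 = Q 3 * P 4"
    using eq by (simp add: P_def Q_def cross_equation_def ac_simps)
  then obtain s t where st: "s \<noteq> 0 \<or> t \<noteq> 0" and "s * P 3 + t * Q 3 = 0" "s * P 4 + t * Q 4 = 0"
    using two_by_two_singular_iff by blast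
  then have form: "s * P i + t * Q i = 0" for i
    using exhaust_4 [of i] by (auto simp: P_def Q_def bracket2_def)
  \<comment> \<open>The tensor \<open>u i \<otimes> v i\<close> in coordinates. The form to be evaluated on it is \<open>L\<close>, which corresponds
      to the tensor \<open>C\<close> under the duality \<open>p \<mapsto> [p, \<cdot>]\<close> in both factors.\<close>
  define w :: "4 \<Rightarrow> complex^4" where "w i = (\<chi> j. if j = 1 then u i $ 1 * v i $ 1
      else if j = 2 then u i $ 1 * v i $ 2 else if j = 3 then u i $ 2 * v i $ 1 else u i $ 2 * v i $ 2)" for i
  define C where "C a b = s * u 1 $ a * v 2 $ b + t * u 2 $ a * v 1 $ b" for a b
  define L :: "complex^4" where "L = (\<chi> j. if j = 1 then C 2 2
      else if j = 2 then - C 2 1 else if j = 3 then - C 1 2 else C 1 1)"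
  have L: "pairing L (w i) = 0" for i
  proof -
    have "pairing L (w i) = s * P i + t * Q i"
      by (simp add: pairing_def sum_4 L_def w_def C_def P_def Q_def bracket2_def algebra_simps)
    then show ?thesis by (simp add: form)
  qed
  show ?thesis
  proof (cases "L = 0")
    case False
    then obtain c i where "c i \<noteq> 0" and c: "(\<Sum>i\<in>UNIV. c i *s w i) = 0"
      using L common_annihilator_iff_dependent [of w] by blast
    have "tensor_relation c u v"
      using c by (simp add: tensor_relation_iff_coords vec_eq_iff w_def forall_4 forall_2 ac_simps)
    then show ?thesis using \<open>c i \<noteq> 0\<close> by blast
  next
    case True
    then have C: "s * u 1 $ a * v 2 $ b + t * u 2 $ a * v 1 $ b = 0" for a b
    proof -
      have "C a b = 0"
        using True exhaust_2 [of a] exhaust_2 [of b] by (auto simp: vec_eq_iff forall_4 L_def)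
      then show ?thesis by (simp add: C_def)
    qed
    have nz: "\<exists>a. p $ a \<noteq> 0" if "p \<noteq> 0" for p :: "complex^2"
      using that by (auto simp: vec_eq_iff)
    obtain a1 a2 b1 b2 where ab: "u 1 $ a1 \<noteq> 0" "u 2 $ a2 \<noteq> 0" "v 1 $ b1 \<noteq> 0" "v 2 $ b2 \<noteq> 0"
      using nz u v by metis
    have "s \<noteq> 0" using C [of a2 b1] st ab by auto
    \<comment> \<open>Both \<open>u 1 \<otimes> v 1\<close> and \<open>u 2 \<otimes> v 2\<close> are multiples of \<open>u 2 \<otimes> v 1\<close>, with factors \<open>k\<close> and \<open>m\<close>.\<close>
    define k where "k = - (t * v 1 $ b2) / (s * v 2 $ b2)"
    define m where "m = - (t * u 2 $ a1) / (s * u 1 $ a1)"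
    have k: "u 1 $ a = k * u 2 $ a" for a
      using C [of a b2] ab \<open>s \<noteq> 0\<close> by (simp add: k_def field_simps eq_neg_iff_add_eq_0)
    have m: "v 2 $ b = m * v 1 $ b" for b
      using C [of a1 b] ab \<open>s \<noteq> 0\<close> by (simp add: m_def field_simps eq_neg_iff_add_eq_0)
    define c :: "4 \<Rightarrow> complex" where "c i = (if i = 1 then m else if i = 2 then - k else 0)" for i
    have "tensor_relation c u v"
      by (simp add: tensor_relation_iff_coords sum_4 c_def k m)
    moreover have "c 1 \<noteq> 0" using m [of b2] ab by (auto simp: c_def)
    ultimately show ?thesis by blast
  qed
qed

section \<open>Coordinates on a line\<close>

text \<open>
  The first two rows of a homography that takes a line to \<open>{(*,*,0)}\<close>: dropping the zero coordinate
  is then the linear map \<open>p \<mapsto> frame H *v p\<close>.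
\<close>

definition frame :: "complex^'n^3 \<Rightarrow> complex^'n^2" where
  "frame H = vector [H $ 1, H $ 2]"

lemma bracket_eq_bracket2: "bracket H p q = bracket2 (frame H *v p) (frame H *v q)"
  by (simp add: bracket_eq bracket2_def frame_def matrix_vector_mult_nth)

lemma bracket_equation_wrt_iff:
  "bracket_equation_wrt H K x y \<longleftrightarrow> cross_equation (\<lambda>i. frame H *v x i) (\<lambda>i. frame K *v y i)"
  by (simp add: bracket_equation_wrt_def cross_equation_def bracket_eq_bracket2)

text \<open>
  The dropped coordinate is zero on the line, so the first two columns of the inverse homography
  recover the vector.
\<close>

lemma frame_left_inverse:
  assumes "flattens l H"
  obtains P where "\<And>p. on_line l p \<Longrightarrow> P *v (frame H *v p) = p"
proof -
  obtain G where G: "G ** H = mat 1" using assms by (auto simp: flattens_def invertible_def)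
  define P where "P = (\<chi> a. (vector [G $ a $ 1, G $ a $ 2] :: complex^2))"
  have "P *v (frame H *v p) = p" if "on_line l p" for p
  proof -
    have "(H *v p) $ 3 = 0" using assms that by (simp add: flattens_def)
    then have "P *v (frame H *v p) = G *v (H *v p)"
      by (simp add: vec_eq_iff matrix_vector_mult_nth pairing_def [of "G $ _"] sum_3)
        (simp add: pairing_def [of "vector _"] sum_2 P_def frame_def matrix_vector_mult_nth)
    also have "\<dots> = p" by (simp add: matrix_vector_mul_assoc G)
    finally show ?thesis .
  qed
  then show thesis by (rule that)
qed

text \<open>
  The third row of a homography is the coefficient vector of the line that it sends to \<open>{(*,*,0)}\<close>.
\<close>

lemma flattens_third_row: "invertible H \<Longrightarrow> flattens (H $ 3) H"
  by (simp add: flattens_def on_line_iff_pairing matrix_vector_mult_nth)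

lemma exists_flattens:
  assumes "l \<noteq> 0"
  obtains H where "flattens l H"
proof -
  have "\<exists>a b. det (vector [a, b, l] :: complex^3^3) \<noteq> 0"
  proof (rule ccontr)
    assume "\<not> ?thesis"
    then have *: "det (vector [a, b, l] :: complex^3^3) = 0" for a b by blast
    have "l $ 1 = 0" "l $ 2 = 0" "l $ 3 = 0"
      using * [of "axis 2 1" "axis 3 1"] * [of "axis 1 1" "axis 3 1"] * [of "axis 1 1" "axis 2 1"]
      by (simp_all add: det_3 axis_def)
    then show False using assms by (simp add: vec_eq_iff forall_3)
  qed
  then obtain a b where "invertible (vector [a, b, l] :: complex^3^3)"
    by (auto simp: invertible_det_nz)
  from flattens_third_row [OF this] show thesis by (intro that) simp
qed

lemma pairing_matrix_vector:
  "pairing l (M *v p) = pairing (transpose M *v l) p"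
  unfolding pairing_def matrix_vector_mult_def transpose_def
  by (simp add: sum_distrib_left sum_distrib_right ac_simps) (rule sum.swap)

lemma tensor_relation_image:
  assumes "tensor_relation c x y"
  shows "tensor_relation c (\<lambda>i. A *v x i) (\<lambda>i. B *v y i)"
  using assms by (simp add: tensor_relation_def pairing_matrix_vector)

section \<open>Four points\<close>

lemma bracket_equation_of_relation:
  assumes x: "on_a_line x" and y: "on_a_line y" and rel: "tensor_relation c x y" "c 3 \<noteq> 0"
  shows "bracket_equation x y"
proof -
  obtain l m where lm: "l \<noteq> 0" "m \<noteq> 0" "\<forall>i. on_line l (x i)" "\<forall>i. on_line m (y i)"
    using x y unfolding on_a_line_def by blast
  obtain H K where HK: "flattens l H" "flattens m K"
    using exists_flattens lm(1,2) by metis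
  have "bracket_equation_wrt H K x y"
    unfolding bracket_equation_wrt_iff
    using cross_equation_of_relation tensor_relation_image rel by blast
  then show ?thesis unfolding bracket_equation_def using lm HK by blast
qed

lemma relation_of_bracket_equation:
  assumes x: "representatives x" and y: "representatives y" and eq: "bracket_equation x y"
  shows "\<exists>c. (\<exists>i. c i \<noteq> 0) \<and> tensor_relation c x y"
proof -
  obtain l m H K where l: "\<And>i. on_line l (x i)" and m: "\<And>i. on_line m (y i)"
    and HK: "flattens l H" "flattens m K" and wrt: "bracket_equation_wrt H K x y"
    using eq unfolding bracket_equation_def by blast
  obtain P where P: "\<And>i. P *v (frame H *v x i) = x i" using frame_left_inverse [OF HK(1)] l by metis
  obtain Q where Q: "\<And>i. Q *v (frame K *v y i) = y i" using frame_left_inverse [OF HK(2)] m by metis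
  have nz: "frame H *v x i \<noteq> 0" "frame K *v y i \<noteq> 0" for i
    using P [of i] Q [of i] x y by (auto simp: representatives_def)
  obtain c i where "c i \<noteq> 0" and rel: "tensor_relation c (\<lambda>i. frame H *v x i) (\<lambda>i. frame K *v y i)"
    using relation_of_cross_equation [OF nz wrt [unfolded bracket_equation_wrt_iff]] by blast
  have "tensor_relation c x y"
    using tensor_relation_image [OF rel, of P Q] by (simp only: P Q)
  then show ?thesis using \<open>c i \<noteq> 0\<close> by blast
qed

lemma rank_Z4_less_iff:
  fixes x y :: "4 \<Rightarrow> complex^3"
  assumes x: "representatives x" and y: "representatives y"
  shows "rank (Z_matrix x y) < 4 \<longleftrightarrow>
          inherited_condition (Z_matrix x y)
        \<or> (same_point (x 1) (x 2) \<and> same_point (x 2) (x 3) \<and> same_point (x 3) (x 4))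
        \<or> (same_point (y 1) (y 2) \<and> same_point (y 2) (y 3) \<and> same_point (y 3) (y 4))
        \<or> (on_a_line x \<and> on_a_line y \<and> bracket_equation x y)"
    (is "_ \<longleftrightarrow> ?inh \<or> ?A x \<or> ?A y \<or> ?B")
proof -
  have all_equal: "rank (Z_matrix x y) < CARD(4)" if "?A x" for x y :: "4 \<Rightarrow> complex^3"
  proof -
    have "same_point (x 1) (x i)" for i
      using exhaust_4 [of i] that same_point_refl same_point_trans by metis
    moreover obtain c j where "c j \<noteq> 0" "(\<Sum>i\<in>UNIV. c i *s y i) = 0"
      by (rule vectors_dependent_of_card [of y]) auto
    ultimately show ?thesis by (rule rank_Z_less_if_constant)
  qed
  have "?A x \<or> ?A y \<or> ?B" if rank: "rank (Z_matrix x y) < CARD(4)" and inh: "\<not> ?inh"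
  proof -
    obtain c where c: "\<And>i. c i \<noteq> 0" and rel: "tensor_relation c x y"
      using rank_less_imp_full_relation [OF rank inh] by blast
    have rel': "tensor_relation c y x" using rel by (rule tensor_relation_swap [THEN iffD1])
    have "on_a_line x" if "\<not> ?A y"
      using on_a_line_if_distinct [OF y rel c] that by blast
    moreover have "on_a_line y" if "\<not> ?A x"
      using on_a_line_if_distinct [OF x rel' c] that by blast
    ultimately show ?thesis using bracket_equation_of_relation rel c by blast
  qed
  moreover have "rank (Z_matrix x y) < CARD(4)" if "?A y"
    using all_equal [of y x] that rank_Z_swap [of x y] by simp
  moreover have "rank (Z_matrix x y) < CARD(4)" if "?B"
    using that relation_of_bracket_equation [OF x y] by (simp only: rank_Z_less_iff)
  ultimately show ?thesis
    using all_equal inherited_imp_rank_less [of "Z_matrix x y"] by auto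
qed

section \<open>Homographies between collinear quadruples\<close>

text \<open>
  If \<open>K\<close> flattens a line through the \<open>y i\<close>, then \<open>K ** H\<close> flattens a line through the \<open>x i\<close>. In these
  coordinates the two sets of brackets agree up to the scalars \<open>c i\<close>, which occur symmetrically on the
  two sides of the equation.
\<close>

lemma bracket_equation_of_homography:
  assumes y: "on_a_line y" and H: "invertible H" "\<And>i. same_point (H *v x i) (y i)"
  shows "bracket_equation x y"
proof -
  obtain m where m: "m \<noteq> 0" "\<And>i. on_line m (y i)" using y unfolding on_a_line_def by blast
  obtain K where K: "flattens m K" using exists_flattens m(1) by metis
  obtain c where c: "\<And>i. c i \<noteq> 0" "\<And>i. y i = c i *s (H *v x i)"
    using H(2) unfolding same_point_def by metis
  have flat: "flattens ((K ** H) $ 3) (K ** H)"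
    using K H(1) by (intro flattens_third_row invertible_mult) (auto simp: flattens_def)
  have Ky: "K *v y i = c i *s (K ** H *v x i)" for i
    by (simp add: c(2) vector_scalar_commute matrix_vector_mul_assoc)
  have "on_line ((K ** H) $ 3) (x i)" for i
  proof -
    have "(K *v y i) $ 3 = 0" using K m(2) by (simp add: flattens_def)
    then have "(K ** H *v x i) $ 3 = 0" using c(1) by (simp add: Ky)
    then show ?thesis using flat by (simp add: flattens_def)
  qed
  moreover have "bracket_equation_wrt (K ** H) K x y"
    by (simp add: bracket_equation_wrt_def bracket_eq Ky algebra_simps)
  ultimately show ?thesis unfolding bracket_equation_def using flat K m(2) by blast
qed

lemma bracket_nonzero_if_distinct:
  assumes "flattens l H" "on_line l p" "on_line l q" "p \<noteq> 0" "q \<noteq> 0" "\<not> same_point p q"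
  shows "bracket H p q \<noteq> 0"
proof
  assume eq: "bracket H p q = 0"
  obtain P where P: "P *v (frame H *v p) = p" "P *v (frame H *v q) = q"
    using frame_left_inverse [OF assms(1)] assms(2,3) by metis
  define u v where "u = frame H *v p" and "v = frame H *v q"
  have uv: "u $ 1 * v $ 2 = u $ 2 * v $ 1"
    using eq by (simp add: bracket_eq_bracket2 bracket2_def u_def v_def)
  have comb: "a *s u + b *s v = 0 \<Longrightarrow> a = 0 \<and> b = 0" for a b
  proof -
    assume "a *s u + b *s v = 0"
    then have "P *v (a *s u + b *s v) = 0" by simp
    then have "a *s p + b *s q = 0"
      by (simp add: matrix_vector_right_distrib vector_scalar_commute P u_def v_def)
    then show ?thesis using independent_of_distinct assms by blast
  qed
  have "v $ 1 *s u + (- u $ 1) *s v = 0" "v $ 2 *s u + (- u $ 2) *s v = 0"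
    using uv by (simp_all add: vec_eq_iff forall_2 algebra_simps)
  from this [THEN comb] have "u = 0" by (simp add: vec_eq_iff forall_2)
  then show False using P assms(4) by (simp add: u_def)
qed

text \<open>
  In flattened coordinates, map \<open>u 1\<close> and \<open>u 2\<close> to multiples of \<open>v 1\<close> and \<open>v 2\<close>. The ratio of the two
  factors can be chosen so that \<open>u 3\<close> goes to a multiple of \<open>v 3\<close>, and the bracket equation is then the
  condition for \<open>u 4\<close> to go to a multiple of \<open>v 4\<close>.
\<close>

lemma homography_of_bracket_equation:
  fixes x y :: "4 \<Rightarrow> complex^3"
  assumes x: "representatives x" "distinct_points x" and y: "representatives y" "distinct_points y"
    and eq: "bracket_equation x y"
  shows "\<exists>H :: complex^3^3. invertible H \<and> (\<forall>i. same_point (H *v x i) (y i))"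
proof -
  obtain l m H K where l: "\<And>i. on_line l (x i)" and m: "\<And>i. on_line m (y i)"
    and HK: "flattens l H" "flattens m K" and wrt: "bracket_equation_wrt H K x y"
    using eq unfolding bracket_equation_def by blast
  define u v where "u i = H *v x i" and "v i = K *v y i" for i
  have u3: "u i $ 3 = 0" and v3: "v i $ 3 = 0" for i
    using l m HK by (auto simp: u_def v_def flattens_def)
  define X where "X i j = u i $ 1 * u j $ 2 - u i $ 2 * u j $ 1" for i j
  define Y where "Y i j = v i $ 1 * v j $ 2 - v i $ 2 * v j $ 1" for i j
  have X: "X i j \<noteq> 0" and Y: "Y i j \<noteq> 0" if "i \<noteq> j" for i j
    using bracket_nonzero_if_distinct [OF HK(1) l l, of i j] x
      bracket_nonzero_if_distinct [OF HK(2) m m, of i j] y that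
    by (auto simp: X_def Y_def u_def v_def bracket_eq distinct_points_def representatives_def)
  have cr: "X 1 3 * X 2 4 * Y 1 4 * Y 2 3 = X 1 4 * X 2 3 * Y 1 3 * Y 2 4"
    using wrt by (simp add: bracket_equation_wrt_def bracket_eq X_def Y_def u_def v_def)
  \<comment> \<open>By Cramer's rule \<open>X 1 2 *s u 3 = X 3 2 *s u 1 + X 1 3 *s u 2\<close>, and similarly for \<open>v 3\<close>. Hence the
      factors must satisfy \<open>a : b = Y 2 3 / X 2 3 : Y 1 3 / X 1 3\<close>; clear denominators.\<close>
  define a where "a = X 1 3 * Y 2 3"
  define b where "b = X 2 3 * Y 1 3"
  \<comment> \<open>Up to the scalar \<open>X 1 2\<close> on the plane, the map \<open>u 1 \<mapsto> a v 1\<close>, \<open>u 2 \<mapsto> b v 2\<close>.\<close>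
  define M :: "complex^3^3" where "M = vector [
     vector [a * u 2 $ 2 * v 1 $ 1 - b * u 1 $ 2 * v 2 $ 1, b * u 1 $ 1 * v 2 $ 1 - a * u 2 $ 1 * v 1 $ 1, 0],
     vector [a * u 2 $ 2 * v 1 $ 2 - b * u 1 $ 2 * v 2 $ 2, b * u 1 $ 1 * v 2 $ 2 - a * u 2 $ 1 * v 1 $ 2, 0],
     vector [0, 0, 1]]"
  have "det M = a * b * X 1 2 * Y 1 2"
    by (simp add: det_3 M_def X_def Y_def algebra_simps)
  then have M: "invertible M" using X Y by (simp add: invertible_det_nz a_def b_def)
  have Mu: "M *v u i = (a * X i 2) *s v 1 + (b * X 1 i) *s v 2" for i
    by (simp add: vec_eq_iff forall_3 matrix_vector_mult_def sum_3 M_def X_def u3 v3 algebra_simps)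
  have cramer: "Y i 2 *s v 1 + Y 1 i *s v 2 = Y 1 2 *s v i" for i
    by (simp add: vec_eq_iff forall_3 Y_def v3 algebra_simps)
  have swap: "X i j = - X j i" "Y i j = - Y j i" for i j by (simp_all add: X_def Y_def)
  have same: "same_point (v i) (M *v u i)"
    if s: "s \<noteq> 0" and e: "a * X i 2 = s * Y i 2" "b * X 1 i = s * Y 1 i" for i s
  proof -
    have "M *v u i = s *s (Y i 2 *s v 1 + Y 1 i *s v 2)"
      unfolding Mu e by (simp add: vector_add_ldistrib vector_smult_assoc)
    also have "\<dots> = (s * Y 1 2) *s v i" by (simp only: cramer vector_smult_assoc)
    finally show ?thesis using s Y [of 1 2]
      unfolding same_point_def by (intro exI [of _ "s * Y 1 2"]) simp
  qed
  have self: "X i i = 0" "Y i i = 0" for i by (simp_all add: X_def Y_def)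
  have "same_point (v 1) (M *v u 1)"
    using X [of 1 2] X [of 1 3] Y [of 2 3] Y [of 1 2]
    by (intro same [of "a * X 1 2 / Y 1 2"]) (auto simp: self a_def)
  moreover have "same_point (v 2) (M *v u 2)"
    using X [of 1 2] X [of 2 3] Y [of 1 3] Y [of 1 2]
    by (intro same [of "b * X 1 2 / Y 1 2"]) (auto simp: self b_def)
  moreover have "same_point (v 3) (M *v u 3)"
    using X [of 1 3] X [of 2 3]
    by (intro same [of "X 1 3 * X 2 3"]) (auto simp: a_def b_def swap [of 3])
  moreover have "same_point (v 4) (M *v u 4)"
    using X [of 1 3] X [of 2 4] Y [of 2 3] Y [of 2 4] cr
    by (intro same [of "a * X 2 4 / Y 2 4"]) (auto simp: a_def b_def swap [of 4] field_simps)
  ultimately have all: "same_point (v i) (M *v u i)" for i using exhaust_4 [of i] by auto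
  obtain G where G: "G ** K = mat 1" "K ** G = mat 1"
    using HK(2) by (auto simp: flattens_def invertible_def)
  have "same_point (G ** M ** H *v x i) (y i)" for i
  proof -
    obtain c where c: "c \<noteq> 0" "M *v u i = c *s v i" using all unfolding same_point_def by blast
    have "G ** M ** H *v x i = G *v (M *v u i)" by (simp add: matrix_vector_mul_assoc u_def matrix_mul_assoc)
    also have "\<dots> = c *s (G *v v i)" by (simp add: c vector_scalar_commute)
    also have "G *v v i = y i" by (simp add: v_def matrix_vector_mul_assoc G)
    finally have "same_point (y i) (G ** M ** H *v x i)" using c(1) unfolding same_point_def by blast
    then show ?thesis by (rule same_point_sym)
  qed
  moreover have "invertible (G ** M ** H)"
    using G M HK(1) by (intro invertible_mult) (auto simp: invertible_def flattens_def)
  ultimately show ?thesis by blast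
qed

section \<open>Generic distinctness\<close>

lemma polynomial_map_prod:
  assumes "finite I" "\<And>i. i \<in> I \<Longrightarrow> polynomial_map (f i)"
  shows "polynomial_map (\<lambda>z. \<Prod>i\<in>I. f i z)"
  using assms by (induction I rule: finite_induct) (auto intro: polynomial_map.intros)

lemma multihomogeneous_mult:
  assumes "multihomogeneous f" "multihomogeneous g"
  shows "multihomogeneous (\<lambda>z. f z * g z)"
proof -
  obtain d e where
    "\<And>c z. f (\<lambda>i. c i *s z i) = (\<Prod>i\<in>UNIV. c i ^ d i) * f z"
    "\<And>c z. g (\<lambda>i. c i *s z i) = (\<Prod>i\<in>UNIV. c i ^ e i) * g z"
    using assms unfolding multihomogeneous_def by metis
  then show ?thesis unfolding multihomogeneous_def
    by (intro exI [of _ "\<lambda>i. d i + e i"]) (simp add: power_add prod.distrib)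
qed

lemma multihomogeneous_prod:
  assumes "finite I" "\<And>i. i \<in> I \<Longrightarrow> multihomogeneous (f i)"
  shows "multihomogeneous (\<lambda>z. \<Prod>i\<in>I. f i z)"
  using assms
proof (induction I rule: finite_induct)
  case empty
  show ?case unfolding multihomogeneous_def by (intro exI [of _ "\<lambda>_. 0"]) simp
qed (auto intro: multihomogeneous_mult)

text \<open>
  One of the three minors is enough: its vanishing does not imply that the points coincide, but a
  relatively open set may be chosen smaller than the set of all pairs with distinct points.
\<close>

definition minor :: "'i \<Rightarrow> 'i \<Rightarrow> ('i \<Rightarrow> complex^3) \<Rightarrow> complex" where
  "minor i j z = z i $ 1 * z j $ 2 - z i $ 2 * z j $ 1"

lemma polynomial_map_minor: "polynomial_map (minor i j)"
proof -
  have "polynomial_map (\<lambda>z. z i $ 1 * z j $ 2 + (-1) * (z i $ 2 * z j $ 1))"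
    by (intro polynomial_map.intros)
  also have "(\<lambda>z. z i $ 1 * z j $ 2 + (-1) * (z i $ 2 * z j $ 1)) = minor i j"
    by (simp add: minor_def fun_eq_iff)
  finally show ?thesis .
qed

lemma multihomogeneous_minor:
  assumes "i \<noteq> j"
  shows "multihomogeneous (minor i j)"
proof -
  have "(\<Prod>k\<in>UNIV. c k ^ (if k = i \<or> k = j then 1 else 0)) = c i * c j" for c :: "_ \<Rightarrow> complex"
  proof -
    have "(\<Prod>k\<in>UNIV. c k ^ (if k = i \<or> k = j then 1 else 0))
        = (\<Prod>k\<in>{i,j}. c k ^ (if k = i \<or> k = j then 1 else 0))"
      by (rule prod.mono_neutral_right) auto
    then show ?thesis using assms by simp
  qed
  then show ?thesis unfolding multihomogeneous_def
    by (intro exI [of _ "\<lambda>k. if k = i \<or> k = j then 1 else 0"]) (simp add: minor_def algebra_simps)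
qed

lemma minor_same_point: "same_point (z i) (z j) \<Longrightarrow> minor i j z = 0"
  by (auto simp: same_point_def minor_def)

lemma polynomial_map_along_curve:
  assumes "polynomial_map f" and "\<And>i k. \<exists>p. \<forall>t. z t i $ k = poly p t"
  shows "\<exists>p. \<forall>t. f (z t) = poly p t"
  using assms(1)
proof induction
  case (const c)
  show ?case by (intro exI [of _ "[:c:]"]) simp
next
  case (coord i k)
  show ?case by (rule assms(2))
next
  case (add f g)
  then show ?case by (metis poly_add)
next
  case (mult f g)
  then show ?case by (metis poly_mult)
qed

lemma on_a_line_imp_span:
  assumes "on_a_line x"
  obtains p q a b where "\<And>i. x i = a i *s p + b i *s q"
proof -
  obtain l H where l: "\<And>i. on_line l (x i)" and H: "flattens l H"
    using assms exists_flattens unfolding on_a_line_def by metis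
  obtain P where P: "\<And>i. P *v (frame H *v x i) = x i"
    using frame_left_inverse [OF H] l by metis
  have "x i = (frame H *v x i) $ 1 *s column 1 P + (frame H *v x i) $ 2 *s column 2 P" for i
    using P [of i] by (simp add: matrix_mult_sum sum_2)
  then show thesis by (rule that)
qed

lemma on_a_line_span: "on_a_line (\<lambda>i. a i *s p + b i *s q)"
proof -
  obtain l where "l \<noteq> 0" "pairing l p = 0" "pairing l q = 0" by (rule line_through_two_points)
  then show ?thesis unfolding on_a_line_def on_line_iff_pairing by (intro exI [of _ l]) simp
qed

text \<open>
  Take for \<open>S\<close> the zero set of the product \<open>f\<close> of the minors of all pairs of points on the same side.
  A point \<open>z\<close> of the variety is joined to one with \<open>f \<noteq> 0\<close> by a curve \<open>c\<close> that moves the coefficients and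
  the spanning vectors of both lines along segments. For a polynomial \<open>g\<close> vanishing outside \<open>S\<close>, the
  product \<open>g f\<close> is zero along the curve, and \<open>f\<close> is not the zero polynomial there; hence \<open>g\<close> is zero
  along the curve, in particular at \<open>z\<close>.
\<close>

lemma generically_distinct:
  "generically_on
       {z :: 4 + 4 \<Rightarrow> complex^3.
          representatives z \<and> on_a_line (z \<circ> Inl) \<and> on_a_line (z \<circ> Inr)}
       (\<lambda>z. distinct_points (z \<circ> Inl) \<and> distinct_points (z \<circ> Inr))"
    (is "generically_on ?V _")
proof -
  define I :: "((4 + 4) \<times> (4 + 4)) set"
    where "I = {s. fst s \<noteq> snd s \<and> isl (fst s) = isl (snd s)}"
  define f :: "(4 + 4 \<Rightarrow> complex^3) \<Rightarrow> complex" where "f z = (\<Prod>s\<in>I. minor (fst s) (snd s) z)" for z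
  define S where "S = {z. representatives z \<and> f z = 0}"
  have f0: "f z \<noteq> 0 \<longleftrightarrow> (\<forall>s\<in>I. minor (fst s) (snd s) z \<noteq> 0)" for z
    by (simp add: f_def)
  have poly_f: "polynomial_map f"
    unfolding f_def by (intro polynomial_map_prod polynomial_map_minor) simp
  have "multihomogeneous f"
    unfolding f_def by (intro multihomogeneous_prod multihomogeneous_minor) (simp_all add: I_def)
  then have closed: "zariski_closed S"
    unfolding zariski_closed_def S_def by (intro exI [of _ "{f}"]) (simp add: poly_f)
  have distinct: "distinct_points (z \<circ> Inl) \<and> distinct_points (z \<circ> Inr)" if "f z \<noteq> 0" for z
  proof -
    have "\<not> same_point (z s) (z s')" if "s \<noteq> s'" "isl s = isl s'" for s s'
      using \<open>f z \<noteq> 0\<close> that minor_same_point [of z s s'] unfolding f0 I_def by force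
    then show ?thesis by (simp add: distinct_points_def)
  qed
  have rep: "representatives z" if "f z \<noteq> 0" for z
    unfolding representatives_def
  proof (intro allI)
    fix s :: "4 + 4"
    \<comment> \<open>Every point takes part in some minor, so it cannot be zero.\<close>
    have "i \<noteq> i + 1" for i :: 4 by simp
    then obtain s' where "s \<noteq> s'" "isl s = isl s'"
      by (cases s) (metis sum.disc(1) sum.inject(1), metis sum.disc(2) sum.inject(2))
    then have "minor s s' z \<noteq> 0" using that unfolding f0 I_def by force
    then show "z s \<noteq> 0" by (auto simp: minor_def)
  qed
  have dense: "?V \<subseteq> T" if T: "zariski_closed T" "?V - S \<subseteq> T" for T
  proof
    fix z assume z: "z \<in> ?V"
    obtain F where F: "\<And>g. g \<in> F \<Longrightarrow> polynomial_map g"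
      and T_eq: "T = {z. representatives z \<and> (\<forall>g\<in>F. g z = 0)}"
      using T(1) unfolding zariski_closed_def by blast
    obtain p q a b where l: "\<And>i. (z \<circ> Inl) i = a i *s p + b i *s q"
      by (rule on_a_line_imp_span [of "z \<circ> Inl"]) (use z in auto)
    obtain p' q' a' b' where r: "\<And>i. (z \<circ> Inr) i = a' i *s p' + b' i *s q'"
      by (rule on_a_line_imp_span [of "z \<circ> Inr"]) (use z in auto)
    define A where "A = case_sum a a'"
    define B where "B = case_sum b b'"
    define P where "P \<beta> = (if \<beta> then p else p')" for \<beta>
    define Q where "Q \<beta> = (if \<beta> then q else q')" for \<beta>
    have z_eq: "z s = A s *s P (isl s) + B s *s Q (isl s)" for s
      using l r by (cases s) (simp_all add: A_def B_def P_def Q_def)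
    define k :: "4 \<Rightarrow> complex" where "k i = (if i = 1 then 1 else if i = 2 then 2 else if i = 3 then 3 else 4)" for i
    have k: "k i = k j \<Longrightarrow> i = j" for i j
      using exhaust_4 [of i] exhaust_4 [of j] by (auto simp: k_def)
    \<comment> \<open>At \<open>t = 0\<close> this is \<open>z\<close>; at \<open>t = 1\<close> it consists of the points \<open>(1, k i, 0)\<close>.\<close>
    define c where "c t s =
        ((1 - t) * A s + t) *s ((1 - t) *s P (isl s) + t *s axis 1 1)
      + ((1 - t) * B s + t * case_sum k k s) *s ((1 - t) *s Q (isl s) + t *s axis 2 1)" for t s
    have c0: "c 0 = z" by (simp add: c_def z_eq fun_eq_iff)
    have c_poly: "\<exists>p. \<forall>t. c t s $ j = poly p t" for s j
      by (intro exI [of _ "([:1, -1:] * [:A s:] + [:0, 1:]) * ([:1, -1:] * [:P (isl s) $ j:] + [:0, 1:] * [:axis 1 1 $ j:])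
        + ([:1, -1:] * [:B s:] + [:0, 1:] * [:case_sum k k s:]) * ([:1, -1:] * [:Q (isl s) $ j:] + [:0, 1:] * [:axis 2 1 $ j:])"])
        (simp add: c_def algebra_simps)
    have "minor s s' (c 1) \<noteq> 0" if "(s, s') \<in> I" for s s'
      using that k by (cases s; cases s') (auto simp: I_def minor_def c_def axis_def)
    then have f1: "f (c 1) \<noteq> 0" by (auto simp: f0)
    obtain R where R: "\<And>t. f (c t) = poly R t"
      using polynomial_map_along_curve [of f c] poly_f c_poly by metis
    have "R \<noteq> 0" using f1 R by auto
    have "g z = 0" if g: "g \<in> F" for g
    proof -
      obtain G where G: "\<And>t. g (c t) = poly G t"
        using polynomial_map_along_curve [of g c] F [OF g] c_poly by metis
      have "poly (G * R) t = 0" for t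
      proof (cases "f (c t) = 0")
        case False
        have "on_a_line (c t \<circ> Inl)" "on_a_line (c t \<circ> Inr)"
          by (simp_all only: c_def comp_def sum.disc on_a_line_span)
        then have "c t \<in> ?V - S" using rep False by (simp add: S_def)
        then have "g (c t) = 0" using T(2) g T_eq by blast
        then show ?thesis by (simp add: G)
      qed (simp add: R)
      then have "G * R = 0" using poly_all_0_iff_0 by blast
      then have "G = 0" using \<open>R \<noteq> 0\<close> by simp
      then show "g z = 0" using G [of 0] by (simp add: c0)
    qed
    then show "z \<in> T" using z by (simp add: T_eq)
  qed
  show ?thesis unfolding generically_on_def
    using closed dense distinct by (intro exI [of _ S]) (auto simp: S_def)
qed

theorem theorem4p2:
  shows
   "(\<forall>x y :: 2 \<Rightarrow> complex^3. representatives x \<and> representatives y \<longrightarrow>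
       (rank (Z_matrix x y) < 2 \<longleftrightarrow>
          same_point (x 1) (x 2) \<and> same_point (y 1) (y 2)))
  \<and> (\<forall>x y :: 3 \<Rightarrow> complex^3. representatives x \<and> representatives y \<longrightarrow>
       (rank (Z_matrix x y) < 3 \<longleftrightarrow>
          inherited_condition (Z_matrix x y)
        \<or> (same_point (x 1) (x 2) \<and> same_point (x 2) (x 3) \<and> on_a_line y)
        \<or> (on_a_line x \<and> same_point (y 1) (y 2) \<and> same_point (y 2) (y 3))))
  \<and> (\<forall>x y :: 4 \<Rightarrow> complex^3. representatives x \<and> representatives y \<longrightarrow>
       (rank (Z_matrix x y) < 4 \<longleftrightarrow>
          inherited_condition (Z_matrix x y)
        \<or> (same_point (x 1) (x 2) \<and> same_point (x 2) (x 3) \<and> same_point (x 3) (x 4))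
        \<or> (same_point (y 1) (y 2) \<and> same_point (y 2) (y 3) \<and> same_point (y 3) (y 4))
        \<or> (on_a_line x \<and> on_a_line y \<and> bracket_equation x y)))
  \<and> generically_on
       {z :: 4 + 4 \<Rightarrow> complex^3.
          representatives z \<and> on_a_line (z \<circ> Inl) \<and> on_a_line (z \<circ> Inr)}
       (\<lambda>z. distinct_points (z \<circ> Inl) \<and> distinct_points (z \<circ> Inr))
  \<and> (\<forall>x y :: 4 \<Rightarrow> complex^3. representatives x \<and> representatives y \<longrightarrow>
       on_a_line x \<and> on_a_line y \<and> distinct_points x \<and> distinct_points y \<longrightarrow>
       (bracket_equation x y \<longleftrightarrow>
          (\<exists>H :: complex^3^3. invertible H \<and> (\<forall>i. same_point (H *v x i) (y i)))))"
proof (intro conjI allI impI, goal_cases)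
  case (1 x y)
  then show ?case by (intro rank_Z2_less_iff) auto
next
  case (2 x y)
  then show ?case by (intro rank_Z3_less_iff) auto
next
  case (3 x y)
  then show ?case by (intro rank_Z4_less_iff) auto
next
  case 4
  show ?case by (rule generically_distinct)
next
  case (5 x y)
  then show ?case
    using homography_of_bracket_equation [of x y] bracket_equation_of_homography [of y _ x] by blast
qed

end
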